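(* Let $n$ and $r$ be positive integers with $d_2(n)>0$. Then $A^r_n$ has at least $$r-u_2(r)+n-1-r\cdot d_2(n)$$ factors of $2$.
   Context: Write $[m]=\{1,2,\ldots,m\}$. For a permutation $\pi$ in the symmetric group $\mathfrak{S}_n$, its descent set is $\mathrm{Des}(\pi)=\{i\in[n-1] : \pi_i>\pi_{i+1}\}$. For $S\subseteq[n-1]$, $\beta_n(S)=|\{\pi\in\mathfrak{S}_n : \mathrm{Des}(\pi)=S\}|$. Define $A^r_n=\sum_{S\subseteq[n-1]}\beta_n(S)^r$. For a positive integer $m$, $u_2(m)$ is the sum of the binary digits of $m$, and $d_2(m)=u_2(m)-1$. An integer $N$ has at least $c$ factors of $2$ if the $2$-adic valuation of $N$ is at least $c$. *)

theory Defs
  imports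
    Complex_Main
    "HOL-Combinatorics.Permutations"
    "HOL-Computational_Algebra.Primes"
begin

definition descent_set :: "nat \<Rightarrow> (nat \<Rightarrow> nat) \<Rightarrow> nat set"
  where "descent_set n p = {i \<in> {1..n-1}. p i > p (i + 1)}"

definition beta :: "nat \<Rightarrow> nat set \<Rightarrow> nat"
  where "beta n S = card {p. p permutes {1..n} \<and> descent_set n p = S}"

definition A_sum :: "nat \<Rightarrow> nat \<Rightarrow> nat"
  where "A_sum r n = (\<Sum>S\<in>Pow {1..n-1}. beta n S ^ r)"

text \<open>The range of summation covers all nonzero binary digits, since \<open>m < 2 ^ m\<close>.\<close>

definition u2 :: "nat \<Rightarrow> nat"
  where "u2 m = (\<Sum>i<m. m div 2 ^ i mod 2)"

text \<open>The subtraction is not truncated when \<open>m > 0\<close>, as then \<open>u2 m \<ge> 1\<close>.\<close>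

definition d2 :: "nat \<Rightarrow> nat"
  where "d2 m = u2 m - 1"

end

(*
  Expand the indicator of Des(p) = S as the product over i of (1 - e_i)/2 + a_i e_i, where
  e_i = -1 if i is in S and 1 otherwise, and a_i indicates an ascent of p at i. Summing over p
  writes 2^(n-1) beta_n(S) as a polynomial in the e_i whose coefficients involve 2^|U| N(U), with
  N(U) the number of permutations ascending at all positions of U. Since N(U) = n! / |Y| for a
  Young subgroup Y with v_2(|Y|) <= |U|, these are divisible by the 2-part of n!, which is
  2^(n-1-d_2(n)). So g(S) = 2^(d_2(n)) beta_n(S) is an integral combination of characters of
  (Z/2)^(n-1), and g({}) is even as d_2(n) > 0. For such g one has g^2 = 2h with h of the same
  kind, and iterating this gives g^r = 2^(v_2(r!)) h. Summing h over all S gains 2^(n-1) by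
  orthogonality of characters; finally v_2(r!) = r - u_2(r).
*)

theory Submission
  imports Defs
begin

section \<open>Powers of two in factorials\<close>

text \<open>For \<open>i \<ge> m\<close> the digit at \<open>i\<close> vanishes, as
  \<open>m < 2 ^ i\<close>. This frees the digit recursions from the dependence of the range in
  \<open>u2\<close> on its argument.\<close>

lemma sum_binary_digits:
  assumes "k \<ge> m"
  shows "(\<Sum>i<k. m div 2 ^ i mod 2) = u2 m"
  unfolding u2_def
proof (rule sum.mono_neutral_right)
  show "\<forall>i\<in>{..<k} - {..<m}. m div 2 ^ i mod 2 = 0"
  proof
    fix i assume "i \<in> {..<k} - {..<m}"
    then have "m < 2 ^ i"
      by (intro le_less_trans[of m i]) auto
    then show "m div 2 ^ i mod 2 = 0" by simp
  qed
qed (use assms in auto)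

lemma u2_double: "u2 (2 * m) = u2 m"
proof (cases "m = 0")
  case False
  \<comment> \<open>Dropping the lowest digit 0 leaves \<open>k = 2 * m - 1\<close> digit positions,
    still enough for \<open>m\<close> because \<open>m\<close> is positive.\<close>
  then obtain k where k: "2 * m = Suc k" "k \<ge> m"
    by (cases "2 * m") auto
  then have "u2 (2 * m) = (\<Sum>i<Suc k. 2 * m div 2 ^ i mod 2)"
    by (simp add: u2_def)
  also have "\<dots> = (\<Sum>i<k. m div 2 ^ i mod 2)"
    by (subst sum.lessThan_Suc_shift) simp
  finally show ?thesis using k by (simp add: sum_binary_digits)
qed simp

lemma u2_Suc_double: "u2 (Suc (2 * m)) = Suc (u2 m)"
proof -
  have "u2 (Suc (2 * m)) = Suc (\<Sum>i<2 * m. m div 2 ^ i mod 2)"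
    unfolding u2_def by (subst sum.lessThan_Suc_shift) (simp add: div_mult2_eq)
  then show ?thesis by (simp add: sum_binary_digits)
qed

lemma u2_pos: "m > 0 \<Longrightarrow> u2 m > 0"
proof (induction m rule: less_induct)
  case (less m)
  show ?case
  proof (cases "even m")
    case True
    then obtain k where "m = 2 * k" by blast
    then show ?thesis using less by (simp add: u2_double)
  next
    case False
    then obtain k where "m = Suc (2 * k)" by (auto elim: oddE)
    then show ?thesis by (simp add: u2_Suc_double)
  qed
qed

lemma multiplicity_2_mult:
  "a > 0 \<Longrightarrow> b > 0 \<Longrightarrow> multiplicity 2 (a * b :: nat) = multiplicity 2 a + multiplicity 2 b"
  by (intro prime_elem_multiplicity_mult_distrib) auto

lemma multiplicity_2_double:
  "a > 0 \<Longrightarrow> multiplicity 2 (2 * a :: nat) = Suc (multiplicity 2 a)"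
  by (subst multiplicity_2_mult) auto

lemma multiplicity_fact_Suc_double:
  "multiplicity 2 (fact (Suc (2 * m)) :: nat) = multiplicity 2 (fact (2 * m) :: nat)"
proof -
  have "multiplicity 2 (Suc (2 * m)) = 0"
    by (rule not_dvd_imp_multiplicity_0) simp
  then show ?thesis
    unfolding fact_Suc of_nat_id by (subst multiplicity_2_mult) auto
qed

text \<open>From \<open>m\<close> to \<open>Suc m\<close>, the new odd factor contributes nothing,
  and \<open>2 * Suc m\<close> contributes one factor of 2 more than \<open>Suc m\<close>.\<close>

lemma multiplicity_fact_double:
  "multiplicity 2 (fact (2 * m) :: nat) = m + multiplicity 2 (fact m :: nat)"
proof (induction m)
  case (Suc m)
  have "fact (2 * Suc m) = (2 * Suc m) * (fact (Suc (2 * m)) :: nat)"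
    by (simp add: algebra_simps)
  then have "multiplicity 2 (fact (2 * Suc m) :: nat)
      = Suc (multiplicity 2 (Suc m)) + multiplicity 2 (fact (Suc (2 * m)) :: nat)"
    by (simp only: multiplicity_2_mult[of "2 * Suc m"] multiplicity_2_double fact_gt_zero
        zero_less_Suc mult_pos_pos zero_less_numeral)
  also have "\<dots> = Suc m + (multiplicity 2 (Suc m) + multiplicity 2 (fact m :: nat))"
    by (simp only: multiplicity_fact_Suc_double Suc.IH)
  also have "multiplicity 2 (Suc m) + multiplicity 2 (fact m :: nat) = multiplicity 2 (fact (Suc m) :: nat)"
    unfolding fact_Suc of_nat_id by (subst multiplicity_2_mult) auto
  finally show ?case .
qed simp

text \<open>Legendre's formula for the prime 2, by halving \<open>m\<close>. The additive form
  avoids truncated subtraction.\<close>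

lemma multiplicity_fact_plus_u2: "multiplicity 2 (fact m :: nat) + u2 m = m"
proof (induction m rule: less_induct)
  case (less m)
  consider "m = 0" | k where "m = 2 * k" "k < m" | k where "m = Suc (2 * k)" "k < m"
    by (cases "even m") (fastforce elim!: evenE oddE)+
  then show ?case
  proof cases
    case 1
    then show ?thesis by (simp add: u2_def)
  next
    case 2
    then show ?thesis using less[of k] by (simp add: u2_double multiplicity_fact_double)
  next
    case 3
    then show ?thesis using less[of k]
      by (simp add: u2_Suc_double multiplicity_fact_double multiplicity_fact_Suc_double del: fact_Suc)
  qed
qed

section \<open>Permutations with prescribed ascents\<close>

text \<open>The ground set \<open>V\<close> is arbitrary because the block recursion deletes entries
  from it. Positions start at 0; the counting lemmas keep \<open>Suc i\<close> within the list for
  \<open>i\<close> in \<open>U\<close>.\<close>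

definition asc_lists :: "nat set \<Rightarrow> nat set \<Rightarrow> nat list set"
  where "asc_lists V U = {xs. distinct xs \<and> set xs = V \<and> (\<forall>i\<in>U. xs ! i < xs ! Suc i)}"

lemma finite_asc_lists: "finite V \<Longrightarrow> finite (asc_lists V U)"
  unfolding asc_lists_def
  by (rule finite_subset[OF _ finite_subset_distinct[of V]]) auto

text \<open>A list is cut after its first block, whose \<open>Suc c\<close> entries must be increasing.\<close>

lemma bij_betw_asc_lists:
  assumes V: "finite V" and U: "U \<subseteq> {i. Suc i < card V}"
    and c: "{..<c} \<subseteq> U" "c \<notin> U" "Suc c \<le> card V"
  shows "bij_betw (\<lambda>(B, ys). sorted_list_of_set B @ ys)
    (SIGMA B:{B. B \<subseteq> V \<and> card B = Suc c}. asc_lists (V - B) {i. i + Suc c \<in> U}) (asc_lists V U)"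
    (is "bij_betw ?f ?A _")
proof (rule bij_betwI')
  fix x y assume "x \<in> ?A" "y \<in> ?A"
  \<comment> \<open>Both first blocks have length \<open>Suc c\<close>, so the cut is unique, and a
    finite set is recovered from its sorted list.\<close>
  then show "(?f x = ?f y) = (x = y)"
    using V by (auto simp: append_eq_append_conv dest: finite_subset)
      (metis finite_subset set_sorted_list_of_set)+
next
  fix x assume "x \<in> ?A"
  then obtain B ys where x: "x = (B, ys)" and B: "B \<subseteq> V" "card B = Suc c"
    and ys: "distinct ys" "set ys = V - B" "\<And>i. i + Suc c \<in> U \<Longrightarrow> ys ! i < ys ! Suc i"
    by (auto simp: asc_lists_def)
  have fB: "finite B" using B V finite_subset by blast
  let ?xs = "sorted_list_of_set B"
  have "(?xs @ ys) ! i < (?xs @ ys) ! Suc i" if "i \<in> U" for i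
  \<comment> \<open>Position \<open>c\<close>, where the two blocks meet, is not in
    \<open>U\<close>; every other position compares entries of one part only.\<close>
  proof (cases "i < c")
    case True
    then show ?thesis
      using B sorted_wrt_nth_less[OF strict_sorted_list_of_set[of B], of i "Suc i"]
      by (simp add: nth_append)
  next
    case False
    with that c have "c < i" by (metis linorder_neqE_nat)
    then obtain j where "i = j + Suc c" by (metis add.commute less_iff_Suc_add add_Suc_right add_Suc)
    then show ?thesis using ys(3)[of j] that B by (simp add: nth_append)
  qed
  then show "?f x \<in> asc_lists V U"
    using x B ys fB by (auto simp: asc_lists_def)
next
  fix xs assume "xs \<in> asc_lists V U"
  then have xs: "distinct xs" "set xs = V" "\<And>i. i \<in> U \<Longrightarrow> xs ! i < xs ! Suc i"
    by (auto simp: asc_lists_def)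
  have len: "length xs = card V" using xs distinct_card by fastforce
  \<comment> \<open>All positions below \<open>c\<close> lie in \<open>U\<close>, so the first
    \<open>Suc c\<close> entries are determined by their set.\<close>
  have "sorted (take (Suc c) xs)"
    unfolding sorted_iff_nth_Suc using c len xs(3) by (auto intro!: less_imp_le)
  then have "sorted_list_of_set (set (take (Suc c) xs)) = take (Suc c) xs"
    using xs(1) by (intro sorted_list_of_set.idem_if_sorted_distinct) auto
  moreover have "card (set (take (Suc c) xs)) = Suc c"
    using distinct_card[of "take (Suc c) xs"] xs(1) c len by simp
  moreover have "set (drop (Suc c) xs) = V - set (take (Suc c) xs)"
    using xs(1,2) set_take_disj_set_drop_if_distinct[of xs "Suc c" "Suc c"]
    by (metis Diff_cancel Un_Diff Diff_triv append_take_drop_id inf_commute set_append sup_bot.left_neutral order_refl)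
  moreover have "drop (Suc c) xs ! i < drop (Suc c) xs ! Suc i" if "i + Suc c \<in> U" for i
    using xs(3)[OF that] that U len by (auto simp: add.commute)
  ultimately have "(set (take (Suc c) xs), drop (Suc c) xs) \<in> ?A"
    using xs set_take_subset[of "Suc c" xs] by (auto simp: asc_lists_def)
  moreover have "xs = ?f (set (take (Suc c) xs), drop (Suc c) xs)"
    using \<open>sorted_list_of_set _ = _\<close> by simp
  ultimately show "\<exists>x\<in>?A. xs = ?f x" by blast
qed

text \<open>\<open>K\<close> is the product of the factorials of the block sizes, that is, the order of a Young subgroup.\<close>

lemma card_asc_lists:
  assumes "U \<subseteq> {i. Suc i < n}"
  shows "\<exists>K>0. multiplicity 2 K \<le> card U \<and>
    (\<forall>V. finite V \<and> card V = n \<longrightarrow> card (asc_lists V U) * K = fact n)"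
  using assms
proof (induction n arbitrary: U rule: less_induct)
  case (less n)
  show ?case
  proof (cases "n = 0")
    case True
    with less.prems have "U = {}" by auto
    then have L: "asc_lists {} U = {[]}" by (auto simp: asc_lists_def)
    have "card (asc_lists V U) * 1 = fact n" if "finite V \<and> card V = n" for V
    proof -
      have "V = {}" using that True by auto
      then show ?thesis using L True by simp
    qed
    then show ?thesis by (intro exI[of _ 1]) simp
  next
    case False
    \<comment> \<open>The first position without a prescribed ascent ends the first block, which
      therefore has length \<open>Suc c\<close>.\<close>
    define c where "c = (LEAST c. c \<notin> U)"
    have "n - 1 \<notin> U" using less.prems False by auto
    then have cU: "c \<notin> U" and "c \<le> n - 1" unfolding c_def by (rule LeastI, rule Least_le)
    then have cn: "Suc c \<le> n" using False by simp
    have c_sub: "{..<c} \<subseteq> U" unfolding c_def using not_less_Least by blast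
    define U' where "U' = {i. i + Suc c \<in> U}"
    have "U' \<subseteq> {i. Suc i < n - Suc c}" using less.prems by (auto simp: U'_def)
    \<comment> \<open>One \<open>K\<close> serves all ground sets of this size, so it can be used
      for every \<open>V - B\<close> in the sum over first blocks \<open>B\<close>.\<close>
    with less.IH[of "n - Suc c" U'] cn obtain K where K: "K > 0" "multiplicity 2 K \<le> card U'"
      "\<And>V. finite V \<Longrightarrow> card V = n - Suc c \<Longrightarrow> card (asc_lists V U') * K = fact (n - Suc c)"
      by auto
    have U_eq: "U = {..<c} \<union> (\<lambda>i. i + Suc c) ` U'"
    proof (intro equalityI subsetI)
      fix i assume i: "i \<in> U"
      show "i \<in> {..<c} \<union> (\<lambda>i. i + Suc c) ` U'"
      proof (cases "i < c")
        case False
        with i cU have "i = (i - Suc c) + Suc c" by (cases "i = c") auto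
        with i show ?thesis unfolding U'_def by (metis (mono_tags) UnI2 imageI mem_Collect_eq)
      qed simp
    qed (use c_sub in \<open>auto simp: U'_def\<close>)
    have "finite U'" using less.prems
      by (intro finite_subset[of U' "{..<n}"]) (auto simp: U'_def)
    then have card_U: "card U = c + card U'"
      unfolding U_eq by (subst card_Un_disjoint) (auto simp: card_image inj_on_def)
    have "multiplicity 2 (fact (Suc c) * K) = multiplicity 2 (fact (Suc c) :: nat) + multiplicity 2 K"
      using K by (intro multiplicity_2_mult) auto
    \<comment> \<open>Since \<open>u2 (Suc c) \<ge> 1\<close>, Legendre's formula gives
      \<open>fact (Suc c)\<close> at most \<open>c\<close> factors of 2, and the first block
      accounts for \<open>c\<close> elements of \<open>U\<close>.\<close>
    also have "\<dots> \<le> card U"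
      using K card_U multiplicity_fact_plus_u2[of "Suc c"] u2_pos[of "Suc c"] by linarith
    finally have "multiplicity 2 (fact (Suc c) * K) \<le> card U" .
    moreover have "card (asc_lists V U) * (fact (Suc c) * K) = fact n"
      if V: "finite V" "card V = n" for V
    proof -
      let ?\<B> = "{B. B \<subseteq> V \<and> card B = Suc c}"
      have "card (asc_lists V U) = (\<Sum>B\<in>?\<B>. card (asc_lists (V - B) U'))"
        using bij_betw_asc_lists[of V U c] V less.prems c_sub cU cn
        by (subst bij_betw_same_card[symmetric]) (auto simp: U'_def finite_asc_lists)
      also have "\<dots> * (fact (Suc c) * K) = (\<Sum>B\<in>?\<B>. fact (Suc c) * (card (asc_lists (V - B) U') * K))"
        by (simp add: sum_distrib_left sum_distrib_right mult_ac del: fact_Suc)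
      also have "\<dots> = (\<Sum>B\<in>?\<B>. fact (Suc c) * fact (n - Suc c))"
      proof (rule sum.cong[OF refl])
        fix B assume B: "B \<in> ?\<B>"
        then have "card (V - B) = n - Suc c" using V by (auto simp: card_Diff_subset finite_subset)
        then show "fact (Suc c) * (card (asc_lists (V - B) U') * K) = fact (Suc c) * fact (n - Suc c)"
          using K(3)[of "V - B"] V by simp
      qed
      also have "\<dots> = fact n"
        using V cn binomial_fact_lemma[of "Suc c" n] n_subsets[of V "Suc c"]
        by (simp add: algebra_simps del: fact_Suc)
      finally show ?thesis .
    qed
    ultimately show ?thesis using K(1) by (intro exI[of _ "fact (Suc c) * K"]) auto
  qed
qed

section \<open>From lists to permutations in one-line notation\<close>

definition asc_perms :: "nat \<Rightarrow> nat set \<Rightarrow> (nat \<Rightarrow> nat) set"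
  where "asc_perms n U = {p. p permutes {1..n} \<and> descent_set n p \<inter> U = {}}"

lemma card_asc_perms:
  assumes "U \<subseteq> {1..n-1}"
  shows "card (asc_perms n U) = card (asc_lists {1..n} {i. Suc i \<in> U})"
proof (rule bij_betw_same_card)
  let ?f = "\<lambda>p. map p [1..<Suc n]"
  have nth: "?f p ! i = p (Suc i)" if "i < n" for p :: "nat \<Rightarrow> nat" and i
    using that by (simp del: upt_Suc)
  show "bij_betw ?f (asc_perms n U) (asc_lists {1..n} {i. Suc i \<in> U})"
  proof (rule bij_betwI')
    fix p q assume "p \<in> asc_perms n U" "q \<in> asc_perms n U"
    then have p: "p permutes {1..n}" and q: "q permutes {1..n}" by (auto simp: asc_perms_def)
    show "(?f p = ?f q) = (p = q)"
    proof
      assume "?f p = ?f q"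
      then have "p i = q i" if "i \<in> {1..n}" for i
        using that by (simp del: upt_Suc)
      then show "p = q" using p q by (metis ext permutes_not_in)
    qed simp
  next
    fix p assume "p \<in> asc_perms n U"
    then have p: "p permutes {1..n}" and d: "descent_set n p \<inter> U = {}" by (auto simp: asc_perms_def)
    have "?f p ! i < ?f p ! Suc i" if "Suc i \<in> U" for i
    proof -
      have i: "Suc i < n" "Suc i \<in> {1..n-1}" using that assms by auto
      then have "p (Suc i) \<le> p (Suc (Suc i))" using d that by (auto simp: descent_set_def)
      \<comment> \<open>Injectivity turns the absence of a descent into a strict ascent.\<close>
      moreover have "p (Suc i) \<noteq> p (Suc (Suc i))" using permutes_inj[OF p] by (simp add: inj_eq)
      ultimately show ?thesis using i by (simp only: nth Suc_lessD)
    qed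
    moreover have "distinct (?f p)"
      using permutes_inj_on[OF p] by (simp add: distinct_map inj_on_subset del: upt_Suc)
    moreover have "set (?f p) = {1..n}"
      using permutes_image[OF p] by (simp add: atLeastLessThanSuc_atLeastAtMost del: upt_Suc)
    ultimately show "?f p \<in> asc_lists {1..n} {i. Suc i \<in> U}"
      unfolding asc_lists_def by blast
  next
    fix xs assume "xs \<in> asc_lists {1..n} {i. Suc i \<in> U}"
    then have xs: "distinct xs" "set xs = {1..n}" "\<And>i. Suc i \<in> U \<Longrightarrow> xs ! i < xs ! Suc i"
      by (auto simp: asc_lists_def)
    have len: "length xs = n" using distinct_card[OF xs(1)] xs(2) by simp
    define p where "p = (\<lambda>i. if i \<in> {1..n} then xs ! (i - 1) else i)"
    have eq: "xs = ?f p"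
      by (rule nth_equalityI) (auto simp: len p_def simp del: upt_Suc)
    have "inj_on p {1..n}"
      using eq xs(1) by (metis atLeastLessThanSuc_atLeastAtMost distinct_map set_upt)
    moreover have "p ` {1..n} = {1..n}"
      using eq xs(2) by (metis atLeastLessThanSuc_atLeastAtMost set_map set_upt)
    ultimately have "p permutes {1..n}"
      by (intro bij_imp_permutes) (auto simp: bij_betw_def p_def)
    moreover have "descent_set n p \<inter> U = {}"
    proof -
      have False if "i \<in> descent_set n p" "i \<in> U" for i
      proof -
        have i: "i \<in> {1..n-1}" "p (i + 1) < p i" using that by (auto simp: descent_set_def)
        then obtain j where "i = Suc j" by (cases i) auto
        then show False using i xs(3)[of j] that by (auto simp: p_def split: if_splits)
      qed
      then show ?thesis by blast
    qed
    ultimately show "\<exists>p\<in>asc_perms n U. xs = ?f p"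
      using eq by (auto simp: asc_perms_def)
  qed
qed

text \<open>The count is \<open>fact n\<close> divided by some \<open>K\<close> with at most
  \<open>card U\<close> factors of 2; the power \<open>2 ^ card U\<close> makes up for this
  loss.\<close>

lemma dvd_card_asc_perms:
  assumes U: "U \<subseteq> {1..n-1}"
  shows "2 ^ multiplicity 2 (fact n :: nat) dvd 2 ^ card U * card (asc_perms n U)"
proof -
  let ?U = "{i. Suc i \<in> U}"
  have "card ?U = card (Suc ` ?U)" by (simp add: card_image)
  also have "Suc ` ?U = U"
  proof -
    have "i \<in> Suc ` ?U" if "i \<in> U" for i
      using that U by (cases i) auto
    then show ?thesis by auto
  qed
  finally have card_U: "card ?U = card U" .
  have "?U \<subseteq> {i. Suc i < n}" using U by auto
  from card_asc_lists[OF this] obtain K where K: "K > 0" "multiplicity 2 K \<le> card U"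
    "card (asc_perms n U) * K = fact n"
    using card_asc_perms[OF U] card_U by auto
  then have "card (asc_perms n U) > 0" by (metis fact_nonzero gr0I mult_0)
  then have "multiplicity 2 (fact n :: nat) = multiplicity 2 (card (asc_perms n U)) + multiplicity 2 K"
    using K multiplicity_2_mult by metis
  then have "multiplicity 2 (fact n :: nat) \<le> card U + multiplicity 2 (card (asc_perms n U))"
    using K(2) by simp
  then have "2 ^ multiplicity 2 (fact n :: nat) dvd 2 ^ card U * (2 :: nat) ^ multiplicity 2 (card (asc_perms n U))"
    by (simp only: power_add[symmetric] le_imp_power_dvd)
  also have "\<dots> dvd 2 ^ card U * card (asc_perms n U)"
    by (intro mult_dvd_mono dvd_refl multiplicity_dvd)
  finally show ?thesis .
qed

section \<open>Integer combinations of characters\<close>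

text \<open>The functions \<open>S \<mapsto> \<Prod>i\<in>S. f i\<close> with signs \<open>f i\<close> are the characters of the
  elementary abelian 2-group \<open>Pow A\<close> under symmetric difference.\<close>

inductive char_comb :: "'a set \<Rightarrow> ('a set \<Rightarrow> int) \<Rightarrow> bool" for A
  where
    char: "(\<And>i. f i = 1 \<or> f i = -1) \<Longrightarrow> char_comb A (\<lambda>S. c * (\<Prod>i\<in>A. if i \<in> S then f i else 1))"
  | add: "char_comb A g \<Longrightarrow> char_comb A h \<Longrightarrow> char_comb A (\<lambda>S. g S + h S)"

lemma char_comb_const: "char_comb A (\<lambda>S. c)"
  using char_comb.char[of "\<lambda>_. 1" A c] by simp

text \<open>The sign at \<open>i\<close> is itself a character: its value \<open>f j\<close> is -1
  only for \<open>j = i\<close>.\<close>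

lemma char_comb_sign:
  assumes "finite A" "i \<in> A"
  shows "char_comb A (\<lambda>S. c * (if i \<in> S then -1 else 1))"
proof -
  have "(\<Prod>j\<in>A. if j \<in> S then if j = i then -1 else 1 else 1 :: int)
      = (\<Prod>j\<in>A. if j = i then if i \<in> S then -1 else 1 else 1)" for S
    by (rule prod.cong) auto
  then show ?thesis
    using char_comb.char[of "\<lambda>j. if j = i then -1 else 1" A c] assms by simp
qed

text \<open>A product of two characters is the character of the pointwise products of signs;
  distributivity extends this to combinations.\<close>

lemma char_comb_mult:
  assumes "char_comb A g" "char_comb A h"
  shows "char_comb A (\<lambda>S. g S * h S)"
  using assms
proof (induction arbitrary: h)
  case (char f c)
  from char(2) show ?case
  proof induction
    case (char f' c')
    have "f i * f' i = 1 \<or> f i * f' i = -1" for i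
      using char[of i] \<open>\<And>i. f i = 1 \<or> f i = -1\<close>[of i] by auto
    from char_comb.char[of "\<lambda>i. f i * f' i" A "c * c'", OF this]
    have "char_comb A (\<lambda>S. c * c' * (\<Prod>i\<in>A. if i \<in> S then f i * f' i else 1))" .
    also have "(\<lambda>S. c * c' * (\<Prod>i\<in>A. if i \<in> S then f i * f' i else 1)) =
      (\<lambda>S. c * (\<Prod>i\<in>A. if i \<in> S then f i else 1) * (c' * (\<Prod>i\<in>A. if i \<in> S then f' i else 1)))"
    proof
      fix S
      have "(\<Prod>i\<in>A. if i \<in> S then f i * f' i else 1)
        = (\<Prod>i\<in>A. (if i \<in> S then f i else 1) * (if i \<in> S then f' i else 1))"
        by (rule prod.cong) auto
      then show "c * c' * (\<Prod>i\<in>A. if i \<in> S then f i * f' i else 1) =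
        c * (\<Prod>i\<in>A. if i \<in> S then f i else 1) * (c' * (\<Prod>i\<in>A. if i \<in> S then f' i else 1))"
        by (simp add: prod.distrib)
    qed
    finally show ?case .
  next
    case (add g h)
    then show ?case using char_comb.add by (simp add: distrib_left)
  qed
next
  case (add g1 g2)
  then show ?case using char_comb.add[of A "\<lambda>S. g1 S * h S" "\<lambda>S. g2 S * h S"] by (simp add: distrib_right)
qed

lemma char_comb_prod:
  "(\<And>i. i \<in> I \<Longrightarrow> char_comb A (g i)) \<Longrightarrow> char_comb A (\<lambda>S. \<Prod>i\<in>I. g i S)"
  by (induction I rule: infinite_finite_induct) (auto intro: char_comb_const char_comb_mult)

lemma char_comb_sum:
  "(\<And>i. i \<in> I \<Longrightarrow> char_comb A (g i)) \<Longrightarrow> char_comb A (\<lambda>S. \<Sum>i\<in>I. g i S)"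
  by (induction I rule: infinite_finite_induct) (auto intro: char_comb_const char_comb.add)

text \<open>Orthogonality: the sum of a character over all subsets factors into terms
  \<open>f i + 1\<close>, each 0 or 2.\<close>

lemma char_comb_sum_dvd:
  assumes "char_comb A g" "finite A"
  shows "2 ^ card A dvd (\<Sum>S\<in>Pow A. g S)"
  using assms(1)
proof induction
  case (char f c)
  have "(\<Sum>S\<in>Pow A. \<Prod>i\<in>A. if i \<in> S then f i else 1) = (\<Sum>S\<in>Pow A. prod f S * prod (\<lambda>_. 1) (A - S))"
    using assms(2) by (intro sum.cong) (auto simp: prod.If_cases Int_absorb1)
  also have "\<dots> = (\<Prod>i\<in>A. f i + 1)" using assms(2) by (simp add: prod_add)
  finally have eq: "(\<Sum>S\<in>Pow A. \<Prod>i\<in>A. if i \<in> S then f i else 1) = (\<Prod>i\<in>A. f i + 1)" .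
  have "2 dvd f i + 1" for i using char[of i] by auto
  then have "(\<Prod>i\<in>A. 2) dvd (\<Prod>i\<in>A. f i + 1)" by (intro prod_dvd_prod)
  then show ?case by (simp add: sum_distrib_left[symmetric] eq)
next
  case (add g h)
  then show ?case by (simp add: sum.distrib)
qed

text \<open>Squares of characters are \<open>1\<close> and mixed terms of a square are even.\<close>

lemma char_comb_square:
  assumes "char_comb A g"
  shows "\<exists>h. char_comb A h \<and> (\<forall>S. (g S)\<^sup>2 = 2 * h S + g {})"
  using assms
proof induction
  case (char f c)
  \<comment> \<open>For a single character \<open>g {} = c\<close>, as every factor is 1 at the
    empty set, so the claim reduces to the parity of \<open>c\<^sup>2 - c\<close>.\<close>
  have "2 dvd c\<^sup>2 - c" by simp
  then obtain k where k: "c\<^sup>2 = 2 * k + c" by (metis dvdE diff_add_cancel)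
  have "(\<Prod>i\<in>A. if i \<in> S then f i else 1)\<^sup>2 = 1" for S
  proof -
    have "(if i \<in> S then f i else 1)\<^sup>2 = 1" for i using char[of i] by auto
    then show ?thesis by (simp add: prod_power_distrib)
  qed
  then show ?case using k char_comb_const[of A k]
    by (intro exI[of _ "\<lambda>_. k"]) (simp add: power_mult_distrib)
next
  case (add g1 g2)
  then obtain h1 h2 where h: "char_comb A h1" "char_comb A h2"
    "\<And>S. (g1 S)\<^sup>2 = 2 * h1 S + g1 {}" "\<And>S. (g2 S)\<^sup>2 = 2 * h2 S + g2 {}" by blast
  have "char_comb A (\<lambda>S. (h1 S + h2 S) + g1 S * g2 S)"
    using h add by (intro char_comb.add char_comb_mult)
  moreover have "(g1 S + g2 S)\<^sup>2 = 2 * ((h1 S + h2 S) + g1 S * g2 S) + (g1 {} + g2 {})" for S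
    unfolding power2_sum h by (simp add: algebra_simps)
  ultimately show ?case by blast
qed

text \<open>Halving the exponent follows Legendre's recursion: squaring yields \<open>k\<close>
  factors of 2 for exponent \<open>2 * k\<close>, and the induction hypothesis for exponent
  \<open>k\<close> the rest. An extra factor \<open>g\<close> in the odd case costs nothing.\<close>

lemma char_comb_power:
  assumes "char_comb A g" "even (g {})"
  shows "\<exists>h. char_comb A h \<and> (\<forall>S. g S ^ r = 2 ^ multiplicity 2 (fact r :: nat) * h S)"
  using assms
proof (induction r arbitrary: g rule: less_induct)
  case (less r)
  have even_case: "\<exists>h. char_comb A h \<and> (\<forall>S. g S ^ (2 * k) = 2 ^ multiplicity 2 (fact (2 * k) :: nat) * h S)"
    if "k < r" for k
  proof -
    obtain h where h: "char_comb A h" "\<And>S. (g S)\<^sup>2 = 2 * h S + g {}"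
      using char_comb_square[OF less.prems(1)] by blast
    obtain a where a: "g {} = 2 * a" using less.prems(2) by blast
    define h' where "h' = (\<lambda>S. h S + a)"
    have h': "char_comb A h'" unfolding h'_def using h(1) by (intro char_comb.add char_comb_const)
    have sq: "(g S)\<^sup>2 = 2 * h' S" for S using h(2)[of S] a by (simp add: h'_def)
    \<comment> \<open>Evenness is inherited: \<open>g {} = 2 * a\<close> has square
      \<open>4 * a\<^sup>2\<close>, of which \<open>h' {}\<close> is half.\<close>
    have "2 * h' {} = 2 * (2 * a\<^sup>2)" using sq[of "{}"] a by (simp add: power2_eq_square)
    then have "even (h' {})" by simp
    from less.IH[OF that h' this] obtain q where q: "char_comb A q"
      "\<And>S. h' S ^ k = 2 ^ multiplicity 2 (fact k :: nat) * q S" by blast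
    have "g S ^ (2 * k) = 2 ^ multiplicity 2 (fact (2 * k) :: nat) * q S" for S
      unfolding power_mult sq power_mult_distrib q multiplicity_fact_double
      by (simp add: power_add)
    with q(1) show ?thesis by blast
  qed
  consider "r = 0" | k where "r = 2 * k" "k < r" | k where "r = Suc (2 * k)" "k < r"
    by (cases "even r") (fastforce elim!: evenE oddE)+
  then show ?case
  proof cases
    case 1
    then show ?thesis using char_comb_const[of A 1] by (intro exI[of _ "\<lambda>_. 1"]) simp
  next
    case 2
    then show ?thesis using even_case by blast
  next
    case 3
    then obtain h where h: "char_comb A h"
      "\<And>S. g S ^ (2 * k) = 2 ^ multiplicity 2 (fact (2 * k) :: nat) * h S"
      using even_case by blast
    have "g S ^ r = 2 ^ multiplicity 2 (fact r :: nat) * (g S * h S)" for S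
      unfolding 3 multiplicity_fact_Suc_double power_Suc h by simp
    then show ?thesis using char_comb_mult[OF less.prems(1) h(1)] by blast
  qed
qed

section \<open>Descent set statistics\<close>

text \<open>The factor \<open>2 * a p i * e i + (1 - e i)\<close> is 2 if \<open>S\<close> and the
  descent set of \<open>p\<close> agree at \<open>i\<close>, and 0 otherwise. In the expanded
  product, \<open>U\<close> collects the positions where the first summand is chosen.\<close>

lemma beta_expansion:
  assumes S: "S \<subseteq> {1..n-1}"
  shows "2 ^ (n - 1) * int (beta n S) = (\<Sum>U\<in>Pow {1..n-1}. int (2 ^ card U * card (asc_perms n U)) *
    ((\<Prod>i\<in>U. if i \<in> S then -1 else 1) * (\<Prod>i\<in>{1..n-1} - U. 1 - (if i \<in> S then -1 else 1))))"
proof -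
  let ?A = "{1..n-1}" and ?P = "{p. p permutes {1..n}}"
  define e :: "nat \<Rightarrow> int" where "e i = (if i \<in> S then -1 else 1)" for i
  define a :: "(nat \<Rightarrow> nat) \<Rightarrow> nat \<Rightarrow> int" where "a p i = (if i \<in> descent_set n p then 0 else 1)" for p i
  have finP: "finite ?P" by (simp add: finite_permutations)
  have ind: "2 ^ (n - 1) * (if descent_set n p = S then 1 else 0) = (\<Prod>i\<in>?A. 2 * a p i * e i + (1 - e i))" for p
  proof (cases "descent_set n p = S")
    case True
    then have "(\<Prod>i\<in>?A. 2 * a p i * e i + (1 - e i)) = (\<Prod>i\<in>?A. 2)"
      by (intro prod.cong) (auto simp: a_def e_def)
    with True show ?thesis by simp
  next
    case False
    have "descent_set n p \<subseteq> ?A" by (auto simp: descent_set_def)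
    with False S obtain i where "i \<in> ?A" "(i \<in> descent_set n p) \<noteq> (i \<in> S)" by blast
    then have "\<exists>i\<in>?A. 2 * a p i * e i + (1 - e i) = 0"
      by (intro bexI[of _ i]) (auto simp: a_def e_def)
    with False show ?thesis by (simp add: prod_zero_iff)
  qed
  have asc: "(\<Prod>i\<in>U. 2 * a p i * e i) = 2 ^ card U * (if descent_set n p \<inter> U = {} then 1 else 0) * (\<Prod>i\<in>U. e i)"
    if "U \<in> Pow ?A" for U p
  proof -
    have "finite U" using that finite_subset by blast
    then have "(\<Prod>i\<in>U. a p i) = (if descent_set n p \<inter> U = {} then 1 else 0)"
      by (auto simp: a_def prod_zero_iff intro!: prod.neutral)
    then show ?thesis by (simp add: prod.distrib)
  qed
  have "int (beta n S) = (\<Sum>p\<in>?P. if descent_set n p = S then 1 else 0)"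
    using finP by (simp add: beta_def sum.If_cases Int_def)
  then have "2 ^ (n - 1) * int (beta n S) = (\<Sum>p\<in>?P. \<Prod>i\<in>?A. 2 * a p i * e i + (1 - e i))"
    by (simp only: sum_distrib_left ind)
  also have "\<dots> = (\<Sum>p\<in>?P. \<Sum>U\<in>Pow ?A. (\<Prod>i\<in>U. 2 * a p i * e i) * (\<Prod>i\<in>?A - U. 1 - e i))"
    by (subst prod_add) simp_all
  also have "\<dots> = (\<Sum>U\<in>Pow ?A. \<Sum>p\<in>?P. (\<Prod>i\<in>U. 2 * a p i * e i) * (\<Prod>i\<in>?A - U. 1 - e i))"
    by (rule sum.swap)
  also have "\<dots> = (\<Sum>U\<in>Pow ?A. int (2 ^ card U * card (asc_perms n U)) *
    ((\<Prod>i\<in>U. e i) * (\<Prod>i\<in>?A - U. 1 - e i)))"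
  proof (rule sum.cong[OF refl])
    fix U assume U: "U \<in> Pow ?A"
    have "int (card (asc_perms n U)) = (\<Sum>p\<in>?P. if descent_set n p \<inter> U = {} then 1 else 0)"
      using finP by (simp add: asc_perms_def sum.If_cases Int_def)
    then show "(\<Sum>p\<in>?P. (\<Prod>i\<in>U. 2 * a p i * e i) * (\<Prod>i\<in>?A - U. 1 - e i)) =
      int (2 ^ card U * card (asc_perms n U)) * ((\<Prod>i\<in>U. e i) * (\<Prod>i\<in>?A - U. 1 - e i))"
      unfolding asc[OF U] by (simp add: sum_distrib_left[symmetric] sum_distrib_right[symmetric])
  qed
  finally show ?thesis unfolding e_def .
qed

lemma char_comb_beta:
  assumes "n > 0"
  shows "\<exists>g. char_comb {1..n-1} g \<and> (\<forall>S\<in>Pow {1..n-1}. g S = 2 ^ d2 n * int (beta n S))"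
proof -
  let ?A = "{1..n-1}" and ?v = "multiplicity 2 (fact n :: nat)"
  have v: "n - 1 = ?v + d2 n"
    using multiplicity_fact_plus_u2[of n] u2_pos[OF assms] by (simp add: d2_def)
  have "\<forall>U\<in>Pow ?A. \<exists>k. 2 ^ card U * card (asc_perms n U) = 2 ^ ?v * k"
    using dvd_card_asc_perms by (blast elim: dvdE)
  then obtain k where k: "\<And>U. U \<in> Pow ?A \<Longrightarrow> 2 ^ card U * card (asc_perms n U) = 2 ^ ?v * k U"
    by metis
  \<comment> \<open>This is the expansion divided by the 2-part of \<open>fact n\<close>. The
    difference is written as a sum with coefficient -1 to fit the closure rules.\<close>
  define g where "g = (\<lambda>S. \<Sum>U\<in>Pow ?A. int (k U) *
    ((\<Prod>i\<in>U. if i \<in> S then -1 else 1) * (\<Prod>i\<in>?A - U. 1 + (-1) * (if i \<in> S then -1 else 1))))"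
  have "char_comb ?A (\<lambda>S. if i \<in> S then -1 else 1)" if "i \<in> ?A" for i
    using char_comb_sign[of ?A i 1] that by simp
  then have "char_comb ?A g" unfolding g_def
    by (intro char_comb_sum char_comb_mult char_comb_prod char_comb.add char_comb_const char_comb_sign) auto
  moreover have "g S = 2 ^ d2 n * int (beta n S)" if S: "S \<in> Pow ?A" for S
  proof -
    have "2 ^ ?v * (2 ^ d2 n * int (beta n S)) = 2 ^ (n - 1) * int (beta n S)"
      unfolding v power_add by (rule mult.assoc[symmetric])
    also have "\<dots> = (\<Sum>U\<in>Pow ?A. int (2 ^ ?v * k U) *
      ((\<Prod>i\<in>U. if i \<in> S then -1 else 1) * (\<Prod>i\<in>?A - U. 1 - (if i \<in> S then -1 else 1))))"
      using S by (subst beta_expansion) (auto simp only: k Pow_iff intro!: sum.cong)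
    also have "\<dots> = 2 ^ ?v * g S"
      by (simp add: g_def sum_distrib_left mult.assoc)
    finally show ?thesis by simp
  qed
  ultimately show ?thesis by blast
qed

text \<open>The identity has no descents. Positivity is what lets divisibility bound the valuation,
  since \<open>multiplicity 2 0\<close> is 0 by convention.\<close>

lemma A_sum_pos: "A_sum r n > 0"
proof -
  have "id \<in> {p. p permutes {1..n} \<and> descent_set n p = {}}"
    by (auto simp: permutes_id descent_set_def)
  moreover have "finite {p. p permutes {1..n} \<and> descent_set n p = {}}"
    by (rule finite_subset[OF _ finite_permutations[of "{1..n}"]]) auto
  ultimately have "beta n {} > 0" unfolding beta_def by (metis card_gt_0_iff empty_iff)
  then have "0 < beta n {} ^ r" by simp
  also have "\<dots> \<le> A_sum r n" unfolding A_sum_def by (rule member_le_sum) auto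
  finally show ?thesis .
qed

theorem theorem5p4:
  fixes n r :: nat
  assumes "n > 0" and "r > 0" and "d2 n > 0"
  shows "int (multiplicity 2 (A_sum r n)) \<ge> int r - int (u2 r) + int n - 1 - int r * int (d2 n)"
proof -
  let ?A = "{1..n-1}" and ?v = "multiplicity 2 (fact r :: nat)"
  obtain g where g: "char_comb ?A g" "\<And>S. S \<in> Pow ?A \<Longrightarrow> g S = 2 ^ d2 n * int (beta n S)"
    using char_comb_beta[OF assms(1)] by blast
  have "even (g {})" using g(2)[of "{}"] assms(3) by simp
  from char_comb_power[OF g(1) this, of r] obtain h where h: "char_comb ?A h"
    "\<And>S. g S ^ r = 2 ^ ?v * h S" by blast
  \<comment> \<open>The two sources of factors of 2 combine: powers of \<open>g\<close> give
    \<open>?v\<close>, orthogonality gives \<open>n - 1\<close>.\<close>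
  have "2 ^ ?v * 2 ^ (n - 1) dvd 2 ^ ?v * (\<Sum>S\<in>Pow ?A. h S)"
    using char_comb_sum_dvd[OF h(1)] by (intro mult_dvd_mono) auto
  also have "\<dots> = (\<Sum>S\<in>Pow ?A. g S ^ r)" by (simp add: h(2) sum_distrib_left)
  also have "\<dots> = (\<Sum>S\<in>Pow ?A. 2 ^ (d2 n * r) * int (beta n S) ^ r)"
    by (rule sum.cong) (simp_all add: g(2) power_mult_distrib power_mult)
  also have "\<dots> = int (2 ^ (d2 n * r) * A_sum r n)"
    by (simp add: A_sum_def sum_distrib_left)
  finally have "int (2 ^ (?v + (n - 1))) dvd int (2 ^ (d2 n * r) * A_sum r n)"
    by (simp add: power_add)
  then have "2 ^ (?v + (n - 1)) dvd 2 ^ (d2 n * r) * A_sum r n"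
    by (simp only: int_dvd_int_iff)
  then have "?v + (n - 1) \<le> multiplicity 2 (2 ^ (d2 n * r) * A_sum r n)"
    using A_sum_pos[of r n] by (intro multiplicity_geI) auto
  also have "\<dots> = d2 n * r + multiplicity 2 (A_sum r n)"
    using A_sum_pos[of r n] by (subst multiplicity_2_mult) auto
  \<comment> \<open>The claimed bound can be negative, so the comparison moves to the integers
    before \<open>d2 n * r\<close> is subtracted.\<close>
  finally have "int ?v + int (n - 1) \<le> int (d2 n * r) + int (multiplicity 2 (A_sum r n))"
    by linarith
  then show ?thesis
    using multiplicity_fact_plus_u2[of r] assms(1) by (simp add: algebra_simps of_nat_diff)
qed

end
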